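(* Let $p>0$ and let $\rho$ be an $\mathbb{N}$-valued random variable. The reverse firework process with parameter $p$ and radius distribution $\rho$, as defined in the context, percolates among sceptics if and only if $\mathbb{E}(\rho)=\infty$. Moreover, in case percolation occurs, $\mathbb{P}\{D_{\mathrm{rev}} = [0,\infty)\}=1$.
   Context: $\mathbb{N}=\{0,1,2,\dots\}$ and $\mathbb{R}_+=[0,\infty)$. Let $X_1,X_2,\dots$ be i.i.d. Bernoulli($p$) random variables ($X_i=1$ with probability $p$ and $X_i=0$ with probability $1-p$), and set $X_{-1}=X_0\equiv 1$. Let $\{\rho_i : i\ge -1\}$ be i.i.d. $\mathbb{N}$-valued random variables with the same distribution as $\rho$, independent of $\{X_i : i\ge 1\}$. Define $$D_{\mathrm{rev}} := \{x \in \mathbb{R}_+: x \in [i - \rho_i, i] \text{ for some integer } i \text{ with } X_i = 1 \text{ for which there exist integers } j\ne k \text{ with } -1\leq j,k < i,\ X_j= X_k = 1 \text{ and } j, k \in [i - \rho_i, i]\}.$$ The reverse firework process is said to percolate among sceptics if, with probability $1$, $D_{\mathrm{rev}}$ contains $[t,\infty)$ for some $t\ge 1$.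
   Formalization: The "only if" direction (percolation implies E(ρ)=∞) is stated except when p=1 and ρ≥2 almost surely, where it fails (p=1, ρ≡2 gives D_rev=[0,∞) with E(ρ)=2); the "if" direction and the "moreover" are stated for all p and ρ. *)

theory Defs
  imports "HOL-Probability.Probability"
begin

text \<open>
  The site variables \<^term>\<open>X i\<close> and radii \<^term>\<open>R i\<close> are indexed by integers \<open>i \<ge> -1\<close>; their
  values at indices below \<open>-1\<close> are unconstrained and never used. The generic radius \<open>\<rho>\<close> lives
  on a probability space \<open>N\<close> of its own and only supplies the common law of the \<^term>\<open>R i\<close>.
\<close>

locale reverse_firework = prob_space M + radius: prob_space N
  for M :: "'a measure" and N :: "'b measure" +
  fixes p :: real and \<rho> :: "'b \<Rightarrow> nat"
    and X :: "int \<Rightarrow> 'a \<Rightarrow> nat" and R :: "int \<Rightarrow> 'a \<Rightarrow> nat"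
  assumes X_minus_one: "\<And>\<omega>. \<omega> \<in> space M \<Longrightarrow> X (-1) \<omega> = 1"
    and X_zero: "\<And>\<omega>. \<omega> \<in> space M \<Longrightarrow> X 0 \<omega> = 1"
    and X_indep: "indep_vars (\<lambda>_. count_space UNIV) X {1..}"
    and X_values: "\<And>i \<omega>. 1 \<le> i \<Longrightarrow> \<omega> \<in> space M \<Longrightarrow> X i \<omega> \<in> {0, 1}"
    and X_one: "\<And>i. 1 \<le> i \<Longrightarrow> prob {\<omega> \<in> space M. X i \<omega> = 1} = p"
    and X_null: "\<And>i. 1 \<le> i \<Longrightarrow> prob {\<omega> \<in> space M. X i \<omega> = 0} = 1 - p"
    and radius_measurable: "\<rho> \<in> measurable N (count_space UNIV)"
    and R_indep: "indep_vars (\<lambda>_. count_space UNIV) R {-1..}"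
    and R_distr: "\<And>i. -1 \<le> i \<Longrightarrow>
      distr M (count_space UNIV) (R i) = distr N (count_space UNIV) \<rho>"
    and R_X_indep: "indep_var
      (Pi\<^sub>M {-1..} (\<lambda>_. count_space UNIV)) (\<lambda>\<omega>. \<lambda>i\<in>{-1..}. R i \<omega>)
      (Pi\<^sub>M {1..} (\<lambda>_. count_space UNIV)) (\<lambda>\<omega>. \<lambda>i\<in>{1..}. X i \<omega>)"

definition radius_interval :: "(int \<Rightarrow> nat) \<Rightarrow> int \<Rightarrow> real set" where
  "radius_interval r i = {real_of_int i - real (r i) .. real_of_int i}"

text \<open>A deterministic function of one realisation \<open>x\<close>, \<open>r\<close> of the site variables and the radii.\<close>

definition D_rev :: "(int \<Rightarrow> nat) \<Rightarrow> (int \<Rightarrow> nat) \<Rightarrow> real set" where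
  "D_rev x r = {y. 0 \<le> y \<and> (\<exists>i\<ge>-1. x i = 1 \<and> y \<in> radius_interval r i \<and>
     (\<exists>j k. j \<noteq> k \<and> -1 \<le> j \<and> j < i \<and> -1 \<le> k \<and> k < i \<and> x j = 1 \<and> x k = 1 \<and>
        real_of_int j \<in> radius_interval r i \<and> real_of_int k \<in> radius_interval r i))}"

definition percolates_among_sceptics ::
    "'a measure \<Rightarrow> (int \<Rightarrow> 'a \<Rightarrow> nat) \<Rightarrow> (int \<Rightarrow> 'a \<Rightarrow> nat) \<Rightarrow> bool" where
  "percolates_among_sceptics M X R \<longleftrightarrow>
     (AE \<omega> in M. \<exists>t\<ge>1. {t..} \<subseteq> D_rev (\<lambda>i. X i \<omega>) (\<lambda>i. R i \<omega>))"

end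

theory Submission
  imports Defs
begin

text \<open>
  If \<open>X i = 1\<close> and \<open>R i \<ge> i + 1\<close>, then the interval of \<open>i\<close> contains both \<open>-1\<close> and \<open>0\<close> and
  hence \<open>[0, i] \<subseteq> D_rev\<close>. These events are independent in \<open>i\<close> and their probabilities sum to
  infinity when the mean of \<open>\<rho>\<close> is infinite, so infinitely many of them occur and \<open>D_rev\<close> is the
  whole half line. Conversely, the point \<open>n + 1/2\<close> is uncovered as soon as no site \<open>i = n + m\<close>,
  \<open>m \<ge> 1\<close>, has \<open>X i = 1\<close> and \<open>R i \<ge> max 2 m\<close>. This has probability
  \<open>\<Prod>m\<ge>1. 1 - p * P(\<rho> \<ge> max 2 m)\<close>, which does not depend on \<open>n\<close> and is positive if the mean
  is finite and \<open>p * P(\<rho> \<ge> 2) < 1\<close>, that is, unless \<open>p = 1\<close> and \<open>\<rho> \<ge> 2\<close> almost surely; in that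
  excluded case \<open>D_rev\<close> is the half line anyway.
\<close>

section \<open>Independent events and the second Borel-Cantelli lemma\<close>

context prob_space
begin

text \<open>A one-element family is stable under intersection, so independence extends to the
  sigma-algebras it generates, and these contain the complements.\<close>

lemma indep_events_compl:
  assumes "indep_events A I"
  shows "indep_events (\<lambda>i. space M - A i) I"
proof -
  have "indep_sets (\<lambda>i. sigma_sets (space M) {A i}) I"
    using assms by (intro indep_sets_sigma) (auto simp: indep_events_def_alt Int_stable_def)
  then show ?thesis
    unfolding indep_events_def_alt
    by (rule indep_sets_mono_sets) (auto intro: sigma_sets.intros)
qed

text \<open>Carries independence over from integer sites to sequences indexed by
  \<open>nat\<close>.\<close>

lemma indep_events_reindex:
  assumes "indep_events A I" and "inj_on f K" and "f ` K \<subseteq> I"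
  shows "indep_events (\<lambda>k. A (f k)) K"
proof (rule indep_eventsI)
  show "A (f k) \<in> events" if "k \<in> K" for k
    using assms that by (auto simp: indep_events_def)
  fix J assume J: "J \<subseteq> K" "finite J" "J \<noteq> {}"
  have "prob (\<Inter>j\<in>f ` J. A j) = (\<Prod>j\<in>f ` J. prob (A j))"
    using J assms(3) by (intro indep_setsD[OF assms(1)[unfolded indep_events_def_alt]]) auto
  with J assms(2) show "prob (\<Inter>k\<in>J. A (f k)) = (\<Prod>k\<in>J. prob (A (f k)))"
    by (simp add: prod.reindex inj_on_subset)
qed

lemma prob_no_event_atMost:
  fixes A :: "nat \<Rightarrow> 'a set"
  assumes "indep_events A UNIV"
  shows "prob (\<Inter>m\<le>n. space M - A m) = (\<Prod>m\<le>n. 1 - prob (A m))"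
proof -
  have "A m \<in> events" for m
    using assms by (auto simp: indep_events_def)
  moreover have "prob (\<Inter>m\<in>{..n}. space M - A m) = (\<Prod>m\<in>{..n}. prob (space M - A m))"
    by (rule indep_setsD[OF indep_events_compl[OF assms, unfolded indep_events_def_alt]]) auto
  ultimately show ?thesis
    by (simp add: prob_compl)
qed

lemma prob_no_event_LIMSEQ:
  fixes A :: "nat \<Rightarrow> 'a set"
  assumes "indep_events A UNIV"
  shows "(\<lambda>n. \<Prod>m\<le>n. 1 - prob (A m)) \<longlonglongrightarrow> prob (\<Inter>m. space M - A m)"
proof -
  have [measurable]: "A m \<in> events" for m
    using assms by (auto simp: indep_events_def)
  have "(\<lambda>n. prob (\<Inter>m\<le>n. space M - A m)) \<longlonglongrightarrow> prob (\<Inter>n. \<Inter>m\<le>n. space M - A m)"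
    by (rule finite_Lim_measure_decseq) (auto simp: decseq_def)
  moreover have "(\<Inter>n. \<Inter>m\<le>n. space M - A m) = (\<Inter>m. space M - A m)"
    by auto
  ultimately show ?thesis
    by (simp only: prob_no_event_atMost[OF assms])
qed

text \<open>The estimate \<open>1 - x \<le> exp (- x)\<close> bounds every partial sum by minus the
  logarithm of the probability that no event occurs.\<close>

lemma summable_prob_if_no_event:
  fixes A :: "nat \<Rightarrow> 'a set"
  assumes indep: "indep_events A UNIV" and pos: "0 < prob (\<Inter>m. space M - A m)"
  shows "summable (\<lambda>m. prob (A m))"
proof (rule bounded_imp_summable)
  fix n
  have [measurable]: "A m \<in> events" for m
    using indep by (auto simp: indep_events_def)
  have "prob (\<Inter>m. space M - A m) \<le> prob (\<Inter>m\<le>n. space M - A m)"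
    by (rule finite_measure_mono) auto
  also have "\<dots> = (\<Prod>m\<le>n. 1 - prob (A m))"
    by (rule prob_no_event_atMost[OF indep])
  also have "\<dots> \<le> (\<Prod>m\<le>n. exp (- prob (A m)))"
    using exp_ge_add_one_self[of "- prob (A _)"] by (intro prod_mono) auto
  also have "\<dots> = exp (- (\<Sum>m\<le>n. prob (A m)))"
    by (simp add: exp_sum sum_negf[symmetric])
  finally have "ln (prob (\<Inter>m. space M - A m)) \<le> - (\<Sum>m\<le>n. prob (A m))"
    using pos by (metis ln_exp ln_mono exp_gt_zero)
  then show "(\<Sum>m\<le>n. prob (A m)) \<le> - ln (prob (\<Inter>m. space M - A m))"
    by simp
qed simp

text \<open>Each shifted sequence still has a divergent sum, so by the previous lemma almost surely
  one of its events occurs; countably many shifts are then combined.\<close>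

lemma borel_cantelli_2:
  fixes A :: "nat \<Rightarrow> 'a set"
  assumes indep: "indep_events A UNIV" and div: "\<not> summable (\<lambda>m. prob (A m))"
  shows "AE \<omega> in M. \<forall>n. \<exists>m\<ge>n. \<omega> \<in> A m"
proof -
  have "AE \<omega> in M. \<exists>m\<ge>n. \<omega> \<in> A m" for n
  proof -
    define B where "B m = A (m + n)" for m
    have B: "indep_events B UNIV"
      unfolding B_def by (rule indep_events_reindex[OF indep]) auto
    have [measurable]: "B m \<in> events" for m
      using B by (auto simp: indep_events_def)
    have "\<not> summable (\<lambda>m. prob (B m))"
      using div by (simp add: B_def summable_iff_shift[of "\<lambda>m. prob (A m)"])
    then have "prob (\<Inter>m. space M - B m) = 0"
      using summable_prob_if_no_event[OF B] zero_less_measure_iff by blast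
    then have "AE \<omega> in M. \<omega> \<notin> (\<Inter>m. space M - B m)"
      by (subst (asm) prob_eq_0) auto
    with AE_space show ?thesis
    proof eventually_elim
      case (elim \<omega>)
      then obtain m where "\<omega> \<in> A (m + n)"
        by (auto simp: B_def)
      then show ?case
        using le_add2 by blast
    qed
  qed
  then show ?thesis
    by (simp add: AE_all_countable)
qed

end

section \<open>Deterministic covering criteria\<close>

lemma D_revI:
  assumes "0 \<le> y" "j \<noteq> k" "-1 \<le> j" "j < i" "-1 \<le> k" "k < i" "x i = 1" "x j = 1" "x k = 1"
    and "y \<le> real_of_int i" "real_of_int i \<le> y + real (r i)"
    and "i \<le> j + int (r i)" "i \<le> k + int (r i)"
  shows "y \<in> D_rev x r"
proof -
  have r: "real_of_int j \<in> radius_interval r i" "real_of_int k \<in> radius_interval r i"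
    and y: "y \<in> radius_interval r i" and i: "-1 \<le> i"
    using assms unfolding radius_interval_def atLeastAtMost_iff by linarith+
  show ?thesis
    unfolding D_rev_def
  proof (intro CollectI conjI)
    show "\<exists>i\<ge>-1. x i = 1 \<and> y \<in> radius_interval r i \<and>
        (\<exists>j k. j \<noteq> k \<and> -1 \<le> j \<and> j < i \<and> -1 \<le> k \<and> k < i \<and> x j = 1 \<and> x k = 1 \<and>
          real_of_int j \<in> radius_interval r i \<and> real_of_int k \<in> radius_interval r i)"
      by (rule exI[of _ i], intro conjI i y assms(7), rule exI[of _ j], rule exI[of _ k],
          intro conjI r assms)
  qed (rule assms(1))
qed

lemma D_revE:
  assumes "y \<in> D_rev x r"
  obtains i j k where "0 \<le> y" "j \<noteq> k" "-1 \<le> j" "j < i" "-1 \<le> k" "k < i" "x i = 1" "x j = 1" "x k = 1"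
    and "y \<le> real_of_int i" "real_of_int i \<le> y + real (r i)"
    and "i \<le> j + int (r i)" "i \<le> k + int (r i)"
proof -
  obtain i j k where *: "0 \<le> y" "j \<noteq> k" "-1 \<le> j" "j < i" "-1 \<le> k" "k < i" "x i = 1" "x j = 1" "x k = 1"
      "real_of_int i - real (r i) \<le> y" "y \<le> real_of_int i"
      "real_of_int i - real (r i) \<le> real_of_int j" "real_of_int i - real (r i) \<le> real_of_int k"
    using assms unfolding D_rev_def radius_interval_def by auto
  moreover have "real_of_int i \<le> y + real (r i)" "i \<le> j + int (r i)" "i \<le> k + int (r i)"
    using * by linarith+
  ultimately show ?thesis
    using that by blast
qed

lemma interval_subset_D_rev:
  assumes "x (-1) = 1" "x 0 = 1" "x i = 1" "1 \<le> i" "i + 1 \<le> int (r i)"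
  shows "{0..real_of_int i} \<subseteq> D_rev x r"
proof
  fix y assume y: "y \<in> {0..real_of_int i}"
  have "real_of_int i \<le> real (r i)"
    using assms(5) by linarith
  with y assms show "y \<in> D_rev x r"
    by (intro D_revI[where j = "-1" and k = 0 and i = i]) auto
qed

text \<open>Reaching \<open>n + 1/2\<close> from \<open>i > n\<close> forces
  \<open>r i \<ge> i - n\<close> by integrality, and reaching two distinct sites left of
  \<open>i\<close> forces \<open>r i \<ge> 2\<close>. The resulting condition concerns each site
  separately, which makes independence applicable.\<close>

lemma not_in_D_rev:
  assumes "\<And>i. int n < i \<Longrightarrow> x i = 1 \<Longrightarrow> r i < max 2 (nat (i - int n))"
  shows "real n + 1/2 \<notin> D_rev x r"
proof
  assume "real n + 1/2 \<in> D_rev x r"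
  then show False
  proof (rule D_revE)
    fix i j k
    assume *: "j \<noteq> k" "j < i" "k < i" "x i = 1" "real n + 1/2 \<le> real_of_int i"
      "real_of_int i \<le> real n + 1/2 + real (r i)" "i \<le> j + int (r i)" "i \<le> k + int (r i)"
    have "int n < i" "i \<le> int n + int (r i)"
      using * by linarith+
    with assms[of i] * show False
      by linarith
  qed
qed

text \<open>\<^const>\<open>D_rev\<close> is a union of intervals with integer end points, which makes its being the
  whole half line a countable condition and hence a measurable event.\<close>

lemma D_rev_eq_iff:
  "D_rev x r = {0..} \<longleftrightarrow> (\<forall>n. real n + 1/2 \<in> D_rev x r)"
proof
  assume *: "\<forall>n. real n + 1/2 \<in> D_rev x r"
  show "D_rev x r = {0..}"
  proof (intro equalityI subsetI)
    fix y :: real assume "y \<in> {0..}"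
    define n where "n = nat \<lfloor>y\<rfloor>"
    have n: "real n \<le> y" "y \<le> real n + 1"
      using \<open>y \<in> {0..}\<close> unfolding n_def atLeast_iff by linarith+
    have "real n + 1/2 \<in> D_rev x r"
      using * ..
    then show "y \<in> D_rev x r"
    proof (rule D_revE)
      fix i j k
      assume i: "j \<noteq> k" "-1 \<le> j" "j < i" "-1 \<le> k" "k < i" "x i = 1" "x j = 1" "x k = 1"
        "real n + 1/2 \<le> real_of_int i" "real_of_int i \<le> real n + 1/2 + real (r i)"
        "i \<le> j + int (r i)" "i \<le> k + int (r i)"
      \<comment> \<open>By integrality, an interval containing \<open>n + 1/2\<close> contains all
        of \<open>[n, n + 1]\<close>, hence \<open>y\<close>.\<close>
      have "int n < i" "i \<le> int n + int (r i)"
        using i by linarith+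
      with n have "y \<le> real_of_int i" "real_of_int i \<le> y + real (r i)"
        by linarith+
      with i \<open>y \<in> {0..}\<close> show ?thesis
        by (intro D_revI[where i = i and j = j and k = k]) auto
    qed
  qed (auto simp: D_rev_def)
qed auto

text \<open>Site \<open>n + 1\<close> reaches \<open>n\<close> and \<open>n - 1\<close> and
  therefore covers \<open>n + 1/2\<close>; for \<open>n = 0\<close> the farther neighbour is the
  site \<open>-1\<close>.\<close>

lemma D_rev_eq_if_all_sceptics:
  assumes "\<And>i. -1 \<le> i \<Longrightarrow> x i = 1" and "\<And>i. 1 \<le> i \<Longrightarrow> 2 \<le> r i"
  shows "D_rev x r = {0..}"
  unfolding D_rev_eq_iff
proof
  fix n
  have "2 \<le> r (int n + 1)"
    using assms(2) by simp
  moreover have "x (int n + 1) = 1" "x (int n) = 1" "x (int n - 1) = 1"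
    by (rule assms(1), simp)+
  ultimately show "real n + 1/2 \<in> D_rev x r"
    by (intro D_revI[where j = "int n - 1" and k = "int n" and i = "int n + 1"]) auto
qed

section \<open>Measurability and independence in the random model\<close>

context reverse_firework
begin

lemma X_measurable: "-1 \<le> i \<Longrightarrow> X i \<in> measurable M (count_space UNIV)"
proof -
  assume i: "-1 \<le> i"
  consider "i = -1" | "i = 0" | "1 \<le> i"
    using i by linarith
  then show ?thesis
  proof cases
    case 3
    then show ?thesis
      using X_indep by (auto simp: indep_vars_def)
  qed (auto simp: X_minus_one X_zero cong: measurable_cong)
qed

lemma R_measurable: "-1 \<le> i \<Longrightarrow> R i \<in> measurable M (count_space UNIV)"
  using R_indep by (auto simp: indep_vars_def)

text \<open>The quantifiers range over integers, hence are countable, and the bounds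
  \<open>-1 \<le> i, j, k\<close> confine them to indices with measurable variables.\<close>

lemma D_rev_measurable: "Measurable.pred M (\<lambda>\<omega>. y \<in> D_rev (\<lambda>i. X i \<omega>) (\<lambda>i. R i \<omega>))"
proof -
  note [measurable] = X_measurable R_measurable
  show ?thesis
    unfolding D_rev_def radius_interval_def mem_Collect_eq atLeastAtMost_iff
    by measurable
qed

text \<open>The threshold depends on the site so that one independence result serves three choices:
  \<open>i + 1\<close> to reach the site \<open>-1\<close>, the constant 2, and
  \<open>max 2 (i - n)\<close> for the point \<open>n + 1/2\<close>.\<close>

definition hit :: "(int \<Rightarrow> nat) \<Rightarrow> int \<Rightarrow> 'a set" where
  "hit s i = {\<omega> \<in> space M. X i \<omega> = 1 \<and> s i \<le> R i \<omega>}"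

lemma prob_R: "-1 \<le> i \<Longrightarrow> prob {\<omega> \<in> space M. k \<le> R i \<omega>} = radius.prob {\<omega> \<in> space N. k \<le> \<rho> \<omega>}"
proof -
  assume i: "-1 \<le> i"
  have "measure (distr M (count_space UNIV) (R i)) {k..} = measure (distr N (count_space UNIV) \<rho>) {k..}"
    using R_distr[OF i] by simp
  then show ?thesis
    using R_measurable[OF i] radius_measurable
    by (simp add: measure_distr vimage_def Int_def conj_commute)
qed

text \<open>The event is a cylinder condition on the radii together with one on the site variables.
  Independence of the two families splits it, and independence within each family factors both
  parts. This yields the probability of one hit as well as the independence of all.\<close>

lemma prob_Inter_hit:
  assumes "J \<subseteq> {1..}" "finite J" "J \<noteq> {}"
  shows "prob (\<Inter>i\<in>J. hit s i) = (\<Prod>i\<in>J. p * radius.prob {\<omega> \<in> space N. s i \<le> \<rho> \<omega>})"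
proof -
  let ?R = "\<lambda>\<omega>. \<lambda>i\<in>{-1..}. R i \<omega>" and ?X = "\<lambda>\<omega>. \<lambda>i\<in>{1..}. X i \<omega>"
  let ?A = "{f \<in> space (Pi\<^sub>M {-1..} (\<lambda>_. count_space UNIV)). \<forall>i\<in>J. s i \<le> f i}"
  let ?B = "{f \<in> space (Pi\<^sub>M {1..} (\<lambda>_. count_space UNIV)). \<forall>i\<in>J. f i = 1}"
  have J: "i \<in> {-1..}" "i \<in> {1..}" "-1 \<le> i" "1 \<le> i" if "i \<in> J" for i
    using assms(1) that by auto
  have A: "?A \<in> sets (Pi\<^sub>M {-1..} (\<lambda>_::int. count_space (UNIV::nat set)))"
  proof (intro sets.sets_Collect_finite_All[OF _ assms(2)] predE)
    fix i assume "i \<in> J"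
    then have [measurable]: "(\<lambda>f. f i) \<in> measurable (Pi\<^sub>M {-1..} (\<lambda>_::int. count_space (UNIV::nat set))) (count_space UNIV)"
      by (intro measurable_component_singleton J)
    show "Measurable.pred (Pi\<^sub>M {-1..} (\<lambda>_::int. count_space (UNIV::nat set))) (\<lambda>f. s i \<le> f i)"
      by measurable
  qed
  have B: "?B \<in> sets (Pi\<^sub>M {1..} (\<lambda>_::int. count_space (UNIV::nat set)))"
  proof (intro sets.sets_Collect_finite_All[OF _ assms(2)] predE)
    fix i assume "i \<in> J"
    then have [measurable]: "(\<lambda>f. f i) \<in> measurable (Pi\<^sub>M {1..} (\<lambda>_::int. count_space (UNIV::nat set))) (count_space UNIV)"
      by (intro measurable_component_singleton J)
    show "Measurable.pred (Pi\<^sub>M {1..} (\<lambda>_::int. count_space (UNIV::nat set))) (\<lambda>f. f i = 1)"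
      by measurable
  qed
  have R: "?R -` ?A \<inter> space M = (\<Inter>i\<in>J. R i -` {s i..} \<inter> space M)"
  proof -
    have "(\<forall>i\<in>J. s i \<le> ?R \<omega> i) \<longleftrightarrow> (\<forall>i\<in>J. s i \<le> R i \<omega>)" for \<omega>
      using J(1) by (intro ball_cong) simp_all
    then show ?thesis
      using assms(3) by (auto simp: space_PiM simp del: restrict_apply)
  qed
  have X: "?X -` ?B \<inter> space M = (\<Inter>i\<in>J. X i -` {1} \<inter> space M)"
  proof -
    have "(\<forall>i\<in>J. ?X \<omega> i = 1) \<longleftrightarrow> (\<forall>i\<in>J. X i \<omega> = 1)" for \<omega>
      using J(2) by (intro ball_cong) simp_all
    then show ?thesis
      using assms(3) by (auto simp: space_PiM simp del: restrict_apply)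
  qed
  have "(\<lambda>\<omega>. (?R \<omega>, ?X \<omega>)) -` (?A \<times> ?B) \<inter> space M = (?R -` ?A \<inter> space M) \<inter> (?X -` ?B \<inter> space M)"
    by blast
  also have "\<dots> = (\<Inter>i\<in>J. hit s i)"
    unfolding R X using assms(3) by (auto simp: hit_def)
  finally have "prob (\<Inter>i\<in>J. hit s i) = prob (?R -` ?A \<inter> space M) * prob (?X -` ?B \<inter> space M)"
    using indep_varD[OF R_X_indep A B] by simp
  also have "prob (?R -` ?A \<inter> space M) = (\<Prod>i\<in>J. prob (R i -` {s i..} \<inter> space M))"
    unfolding R using assms J(1) by (intro indep_varsD[OF R_indep]) auto
  also have "\<dots> = (\<Prod>i\<in>J. radius.prob {\<omega> \<in> space N. s i \<le> \<rho> \<omega>})"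
  proof (intro prod.cong)
    fix i assume "i \<in> J"
    then show "prob (R i -` {s i..} \<inter> space M) = radius.prob {\<omega> \<in> space N. s i \<le> \<rho> \<omega>}"
      using prob_R[OF J(3)] by (simp add: vimage_def Int_def conj_commute)
  qed simp
  also have "prob (?X -` ?B \<inter> space M) = (\<Prod>i\<in>J. prob (X i -` {1} \<inter> space M))"
    unfolding X using assms by (intro indep_varsD[OF X_indep]) auto
  also have "\<dots> = (\<Prod>i\<in>J. p)"
  proof (intro prod.cong)
    fix i assume "i \<in> J"
    then show "prob (X i -` {1} \<inter> space M) = p"
      using X_one[OF J(4)] by (simp add: vimage_def Int_def conj_commute)
  qed simp
  finally show ?thesis
    by (simp add: prod.distrib mult.commute)
qed

lemma prob_hit:
  "1 \<le> i \<Longrightarrow> prob (hit s i) = p * radius.prob {\<omega> \<in> space N. s i \<le> \<rho> \<omega>}"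
  using prob_Inter_hit[of "{i}" s] by simp

lemma indep_events_hit: "indep_events (hit s) {1..}"
proof (rule indep_eventsI)
  show "hit s i \<in> events" if "i \<in> {1..}" for i
  proof -
    have [measurable]: "X i \<in> measurable M (count_space UNIV)" "R i \<in> measurable M (count_space UNIV)"
      using that X_measurable R_measurable by auto
    show ?thesis
      unfolding hit_def by measurable
  qed
  fix J :: "int set" assume J: "J \<subseteq> {1..}" "finite J" "J \<noteq> {}"
  show "prob (\<Inter>i\<in>J. hit s i) = (\<Prod>i\<in>J. prob (hit s i))"
    unfolding prob_Inter_hit[OF J] using J by (intro prod.cong) (auto simp: prob_hit)
qed

lemma p_le_1: "p \<le> 1"
  using X_one[of 1] prob_le_1 by (metis order_refl)

text \<open>The tail formula: the mean is the sum of the probabilities of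
  \<open>\<rho> > t\<close>.\<close>

lemma expectation_infinite_iff:
  "(\<integral>\<^sup>+\<omega>. of_nat (\<rho> \<omega>) \<partial>N) = \<infinity> \<longleftrightarrow> \<not> summable (\<lambda>t. radius.prob {\<omega> \<in> space N. t < \<rho> \<omega>})"
proof -
  have "(\<integral>\<^sup>+\<omega>. of_nat (\<rho> \<omega>) \<partial>N) = (\<Sum>t. ennreal (radius.prob {\<omega> \<in> space N. t < \<rho> \<omega>}))"
    using nn_integral_nat_function[OF radius_measurable] by (simp add: radius.emeasure_eq_measure)
  moreover have "summable f \<longleftrightarrow> (\<Sum>t. ennreal (f t)) \<noteq> \<top>" if "\<And>t. 0 \<le> f t" for f :: "nat \<Rightarrow> real"
    using that summable_suminf_not_top suminf_ennreal2 ennreal_neq_top by metis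
  ultimately show ?thesis
    by (simp add: infinity_ennreal_def)
qed

section \<open>Almost sure covering of the half line\<close>

lemma AE_D_rev_eq_if_expectation_infinite:
  assumes "0 < p" and "(\<integral>\<^sup>+\<omega>. of_nat (\<rho> \<omega>) \<partial>N) = \<infinity>"
  shows "AE \<omega> in M. D_rev (\<lambda>i. X i \<omega>) (\<lambda>i. R i \<omega>) = {0..}"
proof -
  define A where "A m = hit (\<lambda>i. nat (i + 1)) (int m + 1)" for m
  have "indep_events A UNIV"
    unfolding A_def by (rule indep_events_reindex[OF indep_events_hit]) (auto simp: inj_on_def)
  moreover have "\<not> summable (\<lambda>m. prob (A m))"
  proof -
    \<comment> \<open>Site \<open>m + 1\<close> needs radius at least \<open>m + 2\<close>, so these
      are the tail probabilities shifted by one, which leaves divergence intact.\<close>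
    have "prob (A m) = p * radius.prob {\<omega> \<in> space N. m + 1 < \<rho> \<omega>}" for m
      unfolding A_def by (subst prob_hit) (auto intro!: arg_cong[where f = radius.prob])
    then show ?thesis
      using assms summable_iff_shift[of "\<lambda>t. radius.prob {\<omega> \<in> space N. t < \<rho> \<omega>}" 1]
      unfolding expectation_infinite_iff by (simp add: summable_cmult_iff)
  qed
  ultimately have "AE \<omega> in M. \<forall>n. \<exists>m\<ge>n. \<omega> \<in> A m"
    by (rule borel_cantelli_2)
  with AE_space show ?thesis
  proof eventually_elim
    case (elim \<omega>)
    show ?case
      unfolding D_rev_eq_iff
    proof
      fix n
      obtain m where "n \<le> m" "\<omega> \<in> A m"
        using elim by auto
      then have "{0..real_of_int (int m + 1)} \<subseteq> D_rev (\<lambda>i. X i \<omega>) (\<lambda>i. R i \<omega>)"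
        using elim by (intro interval_subset_D_rev) (auto simp: A_def hit_def X_minus_one X_zero)
      with \<open>n \<le> m\<close> show "real n + 1/2 \<in> D_rev (\<lambda>i. X i \<omega>) (\<lambda>i. R i \<omega>)"
        by (auto simp: subset_eq)
    qed
  qed
qed

lemma AE_D_rev_eq_if_all_sceptics:
  assumes "p = 1" and "AE \<omega> in N. 2 \<le> \<rho> \<omega>"
  shows "AE \<omega> in M. D_rev (\<lambda>i. X i \<omega>) (\<lambda>i. R i \<omega>) = {0..}"
proof -
  have [measurable]: "\<rho> \<in> measurable N (count_space UNIV)"
    by (rule radius_measurable)
  have "radius.prob {\<omega> \<in> space N. 2 \<le> \<rho> \<omega>} = 1"
    using assms(2) by (subst radius.prob_Collect_eq_1) auto
  then have "AE \<omega> in M. X i \<omega> = 1 \<and> 2 \<le> R i \<omega>" if "1 \<le> i" for i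
  proof -
    have "prob (hit (\<lambda>_. 2) i) = 1"
      using that assms(1) \<open>radius.prob _ = 1\<close> by (simp add: prob_hit)
    moreover have "hit (\<lambda>_. 2) i \<in> events"
      using indep_events_hit that by (auto simp: indep_events_def)
    ultimately have "AE \<omega> in M. \<omega> \<in> hit (\<lambda>_. 2) i"
      by (simp add: prob_eq_1)
    then show ?thesis
      by eventually_elim (simp add: hit_def)
  qed
  then have "AE \<omega> in M. \<forall>i. 1 \<le> i \<longrightarrow> X i \<omega> = 1 \<and> 2 \<le> R i \<omega>"
    by (simp add: AE_all_countable)
  with AE_space show ?thesis
  proof eventually_elim
    case (elim \<omega>)
    have "X i \<omega> = 1" if i: "-1 \<le> i" for i
    proof -
      consider "i = -1" | "i = 0" | "1 \<le> i"
        using i by linarith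
      then show ?thesis
        using elim by cases (auto simp: X_minus_one X_zero)
    qed
    with elim show ?case
      by (intro D_rev_eq_if_all_sceptics) auto
  qed
qed

section \<open>Uncovered points when the mean is finite\<close>

lemma uncovered_prob_bounded_below:
  assumes "0 < p" and "\<not> (p = 1 \<and> (AE \<omega> in N. 2 \<le> \<rho> \<omega>))"
    and "(\<integral>\<^sup>+\<omega>. of_nat (\<rho> \<omega>) \<partial>N) \<noteq> \<infinity>"
  shows "\<exists>c>0. \<forall>n. c \<le> prob {\<omega> \<in> space M. real n + 1/2 \<notin> D_rev (\<lambda>i. X i \<omega>) (\<lambda>i. R i \<omega>)}"
proof -
  note [measurable] = radius_measurable D_rev_measurable
  define a where "a m = p * radius.prob {\<omega> \<in> space N. max 2 (m + 1) \<le> \<rho> \<omega>}" for m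
  \<comment> \<open>This is where the excluded case matters: with \<open>p = 1\<close> and
    \<open>\<rho> \<ge> 2\<close> almost surely, the factor \<open>1 - a 0\<close> would
    vanish.\<close>
  have a_less: "a m < 1" for m
  proof -
    have "a m \<le> p * radius.prob {\<omega> \<in> space N. 2 \<le> \<rho> \<omega>}"
      unfolding a_def using assms(1)
      by (intro mult_left_mono radius.finite_measure_mono) auto
    also have "\<dots> < 1"
    proof (cases "p = 1")
      case True
      then have "radius.prob {\<omega> \<in> space N. 2 \<le> \<rho> \<omega>} \<noteq> 1"
        using assms(2) by (subst radius.prob_Collect_eq_1) auto
      with True show ?thesis
        using radius.prob_le_1[of "{\<omega> \<in> space N. 2 \<le> \<rho> \<omega>}"] by (simp add: less_le)
    next
      case False
      have "p * radius.prob {\<omega> \<in> space N. 2 \<le> \<rho> \<omega>} \<le> p * 1"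
        using assms(1) by (intro mult_left_mono radius.prob_le_1) auto
      with False p_le_1 show ?thesis
        by simp
    qed
    finally show ?thesis .
  qed
  have "summable (\<lambda>m. radius.prob {\<omega> \<in> space N. m < \<rho> \<omega>})"
    using assms(3) unfolding expectation_infinite_iff by simp
  then have "summable (\<lambda>m. radius.prob {\<omega> \<in> space N. max 2 (m + 1) \<le> \<rho> \<omega>})"
  proof (rule summable_comparison_test'[where N = 0])
    fix m
    have "radius.prob {\<omega> \<in> space N. max 2 (m + 1) \<le> \<rho> \<omega>} \<le> radius.prob {\<omega> \<in> space N. m < \<rho> \<omega>}"
      by (rule radius.finite_measure_mono) auto
    then show "norm (radius.prob {\<omega> \<in> space N. max 2 (m + 1) \<le> \<rho> \<omega>})
        \<le> radius.prob {\<omega> \<in> space N. m < \<rho> \<omega>}"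
      by simp
  qed
  then have "summable a"
    unfolding a_def by (rule summable_mult)
  moreover have "0 \<le> a m" for m
    using assms(1) by (simp add: a_def)
  ultimately have "summable (\<lambda>m. \<bar>- a m\<bar>)"
    by simp
  moreover have "- a m \<noteq> -1" for m
    using a_less[of m] by simp
  ultimately have conv: "convergent_prod (\<lambda>m. 1 + - a m)"
    by (rule summable_imp_convergent_prod_real)
  define c where "c = prodinf (\<lambda>m. 1 + - a m)"
  have "0 < c"
    unfolding c_def using a_less by (intro less_0_prodinf conv) simp
  moreover have "c \<le> prob {\<omega> \<in> space M. real n + 1/2 \<notin> D_rev (\<lambda>i. X i \<omega>) (\<lambda>i. R i \<omega>)}" for n
  proof -
    \<comment> \<open>Numbering the sites right of \<open>n\<close> by \<open>m\<close> makes the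
      threshold \<open>max 2 (m + 1)\<close>, so the probability is \<open>a m\<close> for every
      \<open>n\<close>.\<close>
    define A where "A m = hit (\<lambda>i. max 2 (nat (i - int n))) (int n + 1 + int m)" for m
    have "indep_events A UNIV"
      unfolding A_def by (rule indep_events_reindex[OF indep_events_hit]) (auto simp: inj_on_def)
    then have "(\<lambda>k. \<Prod>m\<le>k. 1 - prob (A m)) \<longlonglongrightarrow> prob (\<Inter>m. space M - A m)"
      by (rule prob_no_event_LIMSEQ)
    moreover have "1 - prob (A m) = 1 + - a m" for m
    proof -
      have "nat (int n + 1 + int m - int n) = m + 1"
        by simp
      then show ?thesis
        unfolding A_def a_def by (simp only: prob_hit) simp
    qed
    ultimately have "(\<lambda>k. \<Prod>m\<le>k. 1 + - a m) \<longlonglongrightarrow> prob (\<Inter>m. space M - A m)"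
      by simp
    then have c: "c = prob (\<Inter>m. space M - A m)"
      unfolding c_def using convergent_prod_LIMSEQ[OF conv] LIMSEQ_unique by blast
    have "(\<Inter>m. space M - A m)
        \<subseteq> {\<omega> \<in> space M. real n + 1/2 \<notin> D_rev (\<lambda>i. X i \<omega>) (\<lambda>i. R i \<omega>)}"
    proof
      fix \<omega> assume \<omega>: "\<omega> \<in> (\<Inter>m. space M - A m)"
      have "R i \<omega> < max 2 (nat (i - int n))" if "int n < i" "X i \<omega> = 1" for i
      proof -
        \<comment> \<open>Inverts the numbering of sites used in \<open>A\<close>.\<close>
        have "i = int n + 1 + int (nat (i - int n - 1))"
          using that by simp
        moreover have "\<omega> \<in> space M" "\<omega> \<notin> A (nat (i - int n - 1))"
          using \<omega> by auto
        ultimately show ?thesis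
          using that by (simp add: A_def hit_def not_le less_max_iff_disj)
      qed
      with \<omega> show "\<omega> \<in> {\<omega> \<in> space M. real n + 1/2 \<notin> D_rev (\<lambda>i. X i \<omega>) (\<lambda>i. R i \<omega>)}"
        by (auto intro!: not_in_D_rev)
    qed
    then show ?thesis
      unfolding c by (rule finite_measure_mono) measurable
  qed
  ultimately show ?thesis
    by blast
qed

text \<open>The events \<open>U n\<close> of an uncovered half-integer at or beyond \<open>n\<close>
  decrease and have probability at least \<open>c\<close>. By continuity from above, uncovered
  points are unbounded with probability at least \<open>c\<close>, whereas percolation makes this a
  null event.\<close>

lemma expectation_infinite_if_percolates:
  assumes "0 < p" and "\<not> (p = 1 \<and> (AE \<omega> in N. 2 \<le> \<rho> \<omega>))"
    and perc: "percolates_among_sceptics M X R"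
  shows "(\<integral>\<^sup>+\<omega>. of_nat (\<rho> \<omega>) \<partial>N) = \<infinity>"
proof (rule ccontr)
  note [measurable] = D_rev_measurable
  let ?D = "\<lambda>\<omega>. D_rev (\<lambda>i. X i \<omega>) (\<lambda>i. R i \<omega>)"
  assume "(\<integral>\<^sup>+\<omega>. of_nat (\<rho> \<omega>) \<partial>N) \<noteq> \<infinity>"
  then obtain c :: real where c: "0 < c" "\<And>n. c \<le> prob {\<omega> \<in> space M. real n + 1/2 \<notin> ?D \<omega>}"
    using uncovered_prob_bounded_below[OF assms(1,2)] by blast
  define U where "U n = {\<omega> \<in> space M. \<exists>m\<ge>n. real m + 1/2 \<notin> ?D \<omega>}" for n
  have [measurable]: "U n \<in> events" for n
    unfolding U_def by measurable
  have "(\<lambda>n. prob (U n)) \<longlonglongrightarrow> prob (\<Inter>n. U n)"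
    by (rule finite_Lim_measure_decseq) (auto simp: decseq_def U_def intro: order_trans)
  moreover have "c \<le> prob (U n)" for n
    by (rule order_trans[OF c(2)[of n]]) (auto intro!: finite_measure_mono simp: U_def)
  ultimately have "c \<le> prob (\<Inter>n. U n)"
    by (intro LIMSEQ_le_const) auto
  moreover have "AE \<omega> in M. \<omega> \<notin> (\<Inter>n. U n)"
    using perc unfolding percolates_among_sceptics_def
  proof eventually_elim
    case (elim \<omega>)
    then obtain t where t: "{t..} \<subseteq> ?D \<omega>"
      by auto
    obtain n where "t \<le> real n"
      using real_arch_simple by blast
    then have "\<omega> \<notin> U n"
      using t by (force simp: U_def subset_eq)
    then show ?case
      by auto
  qed
  then have "prob (\<Inter>n. U n) = 0"
    by (subst prob_eq_0) auto
  ultimately show False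
    using c(1) by simp
qed

lemma prob_D_rev_eq_1:
  assumes "AE \<omega> in M. D_rev (\<lambda>i. X i \<omega>) (\<lambda>i. R i \<omega>) = {0..}"
  shows "prob {\<omega> \<in> space M. D_rev (\<lambda>i. X i \<omega>) (\<lambda>i. R i \<omega>) = {0..}} = 1"
proof -
  note [measurable] = D_rev_measurable
  have "{\<omega> \<in> space M. D_rev (\<lambda>i. X i \<omega>) (\<lambda>i. R i \<omega>) = {0..}} \<in> events"
    unfolding D_rev_eq_iff by measurable
  with assms show ?thesis
    by (simp add: prob_Collect_eq_1)
qed

end

text \<open>The equivalence must exclude a case: for \<open>p = 1\<close> and \<open>\<rho>\<close>
  constantly 2 the mean is finite, yet the half line is covered almost surely. The other two
  conjuncts include that case.\<close>

theorem proposition2: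
  fixes M :: "'a measure" and N :: "'b measure" and p :: real and \<rho> :: "'b \<Rightarrow> nat"
    and X R :: "int \<Rightarrow> 'a \<Rightarrow> nat"
  assumes "reverse_firework M N p \<rho> X R"
    and "0 < p"
  shows "(\<not> (p = 1 \<and> (AE \<omega> in N. 2 \<le> \<rho> \<omega>)) \<longrightarrow>
        (percolates_among_sceptics M X R \<longleftrightarrow> (\<integral>\<^sup>+\<omega>. of_nat (\<rho> \<omega>) \<partial>N) = \<infinity>))
    \<and> ((\<integral>\<^sup>+\<omega>. of_nat (\<rho> \<omega>) \<partial>N) = \<infinity> \<longrightarrow> percolates_among_sceptics M X R)
    \<and> (percolates_among_sceptics M X R \<longrightarrow>
        measure M {\<omega> \<in> space M. D_rev (\<lambda>i. X i \<omega>) (\<lambda>i. R i \<omega>) = {0..}} = 1)"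
proof -
  interpret reverse_firework M N p \<rho> X R
    by fact
  have full: "AE \<omega> in M. D_rev (\<lambda>i. X i \<omega>) (\<lambda>i. R i \<omega>) = {0..}"
    if "(\<integral>\<^sup>+\<omega>. of_nat (\<rho> \<omega>) \<partial>N) = \<infinity>"
    using AE_D_rev_eq_if_expectation_infinite assms(2) that by blast
  then have "percolates_among_sceptics M X R" if "(\<integral>\<^sup>+\<omega>. of_nat (\<rho> \<omega>) \<partial>N) = \<infinity>"
    unfolding percolates_among_sceptics_def using that by (auto intro!: exI[of _ 1])
  \<comment> \<open>Percolation leaves either the excluded case, covered directly, or an infinite
    mean.\<close>
  moreover have "AE \<omega> in M. D_rev (\<lambda>i. X i \<omega>) (\<lambda>i. R i \<omega>) = {0..}"
    if "percolates_among_sceptics M X R"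
    using that full expectation_infinite_if_percolates AE_D_rev_eq_if_all_sceptics assms(2) by blast
  ultimately show ?thesis
    using expectation_infinite_if_percolates prob_D_rev_eq_1 assms(2) by blast
qed

end
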